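(* For the disk priority evacuation problem with $k$ Servants (defined in the context), every feasible solution has evacuation cost at least $4.64666$ when $k=1$, and at least $3.65332$ when $k=2$.
   Context: A unit speed trajectory is a map $\tau:\mathbb{R}_{\ge 0}\to\mathbb{R}^2$ with $\|\tau(t_1)-\tau(t_2)\|_2\le |t_1-t_2|$ for all $t_1,t_2\ge0$. In the disk priority evacuation problem with $k$ Servants there are $k+1$ agents labeled $0,\dots,k$ (agent $0$ is the Queen), moving along unit speed trajectories $\tau_0,\dots,\tau_k$ with $\tau_i(0)=(0,0)$ for all $i$. For $\theta\in[0,2\pi)$ let $P_\theta=(\cos\theta,\sin\theta)$. A solution is feasible if for every $\theta$ there exist an agent $i$ and a time $t'$ with $\tau_i(t')=P_\theta$; let $T(\theta)$ be the smallest such $t'$. The evacuation cost is $\sup_{\theta\in[0,2\pi)}\{T(\theta)+\|P_\theta-\tau_0(T(\theta))\|_2\}$. *)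

theory Defs
  imports "HOL-Analysis.Analysis"
begin

text \<open>
  Trajectories are functions on all of \<^typ>\<open>real\<close>, constrained and inspected only at times
  \<open>t \<ge> 0\<close>; likewise only the agents \<open>0, \<dots>, k\<close> of a family indexed by \<^typ>\<open>nat\<close> are relevant.
\<close>

definition unit_speed :: "(real \<Rightarrow> real ^ 2) \<Rightarrow> bool" where
  "unit_speed \<tau> \<longleftrightarrow> (\<forall>t1\<ge>0. \<forall>t2\<ge>0. norm (\<tau> t1 - \<tau> t2) \<le> \<bar>t1 - t2\<bar>)"

definition circle_point :: "real \<Rightarrow> real ^ 2" where
  "circle_point \<theta> = vector [cos \<theta>, sin \<theta>]"

definition evac_solution :: "nat \<Rightarrow> (nat \<Rightarrow> real \<Rightarrow> real ^ 2) \<Rightarrow> bool" where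
  "evac_solution k \<tau> \<longleftrightarrow> (\<forall>i\<le>k. unit_speed (\<tau> i) \<and> \<tau> i 0 = 0)"

definition visited_at :: "nat \<Rightarrow> (nat \<Rightarrow> real \<Rightarrow> real ^ 2) \<Rightarrow> real \<Rightarrow> real \<Rightarrow> bool" where
  "visited_at k \<tau> \<theta> t \<longleftrightarrow> 0 \<le> t \<and> (\<exists>i\<le>k. \<tau> i t = circle_point \<theta>)"

definition feasible :: "nat \<Rightarrow> (nat \<Rightarrow> real \<Rightarrow> real ^ 2) \<Rightarrow> bool" where
  "feasible k \<tau> \<longleftrightarrow> evac_solution k \<tau> \<and> (\<forall>\<theta>\<in>{0..<2 * pi}. \<exists>t. visited_at k \<tau> \<theta> t)"

definition visit_time :: "nat \<Rightarrow> (nat \<Rightarrow> real \<Rightarrow> real ^ 2) \<Rightarrow> real \<Rightarrow> real" where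
  "visit_time k \<tau> \<theta> = (LEAST t. visited_at k \<tau> \<theta> t)"

text \<open>
  The supremum is taken in \<^typ>\<open>ereal\<close>: a feasible solution may have unbounded visit times, and
  then its cost is \<open>\<infinity>\<close>.
\<close>

definition evac_cost :: "nat \<Rightarrow> (nat \<Rightarrow> real \<Rightarrow> real ^ 2) \<Rightarrow> ereal" where
  "evac_cost k \<tau> =
     (SUP \<theta>\<in>{0..<2 * pi}.
        ereal (visit_time k \<tau> \<theta> + norm (circle_point \<theta> - \<tau> 0 (visit_time k \<tau> \<theta>))))"

text \<open>The least visit time exists, so the \<open>LEAST\<close> above is never a junk value.\<close>

lemma unit_speed_continuous_on:
  assumes "unit_speed \<tau>"
  shows "continuous_on {0..} \<tau>"
proof -
  have "1-lipschitz_on {0..} \<tau>"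
    using assms by (auto simp: lipschitz_on_def unit_speed_def dist_norm)
  then show ?thesis
    by (rule lipschitz_on_continuous_on)
qed

lemma visit_time_least:
  assumes "feasible k \<tau>" and "\<theta> \<in> {0..<2 * pi}"
  shows "visited_at k \<tau> \<theta> (visit_time k \<tau> \<theta>)"
    and "\<And>t. visited_at k \<tau> \<theta> t \<Longrightarrow> visit_time k \<tau> \<theta> \<le> t"
proof -
  let ?S = "{t. visited_at k \<tau> \<theta> t}"
  have "closed {t \<in> {0..}. \<tau> i t = circle_point \<theta>}" if "i \<le> k" for i
  proof -
    have "continuous_on {0..} (\<tau> i)"
      using assms(1) that by (auto simp: feasible_def evac_solution_def intro: unit_speed_continuous_on)
    then show ?thesis
      using continuous_closed_preimage_constant[of "{0..}" "\<tau> i"] by simp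
  qed
  then have "closed (\<Union>i\<in>{..k}. {t \<in> {0..}. \<tau> i t = circle_point \<theta>})"
    by (intro closed_UN) auto
  also have "(\<Union>i\<in>{..k}. {t \<in> {0..}. \<tau> i t = circle_point \<theta>}) = ?S"
    by (auto simp: visited_at_def)
  finally have "closed ?S" .
  moreover have "?S \<noteq> {}"
    using assms by (auto simp: feasible_def)
  moreover have bdd: "bdd_below ?S"
    by (rule bdd_belowI[of _ 0]) (auto simp: visited_at_def)
  ultimately have "Inf ?S \<in> ?S"
    by (intro closed_contains_Inf)
  then have *: "visited_at k \<tau> \<theta> (Inf ?S)"
    by simp
  have low: "Inf ?S \<le> t" if "visited_at k \<tau> \<theta> t" for t
    using that bdd by (intro cInf_lower) auto
  have "visit_time k \<tau> \<theta> = Inf ?S"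
    unfolding visit_time_def by (rule Least_equality) (use * low in auto)
  with * low show "visited_at k \<tau> \<theta> (visit_time k \<tau> \<theta>)"
    and "\<And>t. visited_at k \<tau> \<theta> t \<Longrightarrow> visit_time k \<tau> \<theta> \<le> t"
    by auto
qed

end

theory Submission
  imports Defs "HOL-Real_Asymp.Real_Asymp"
begin

text \<open>
  By time \<open>t\<close> the \<open>k + 1\<close> agents have seen an arc length of at most \<open>(k + 1) (t - 1)\<close>. If this is less than
  \<open>\<pi>/6\<close>, some rotated regular dodecagon has no vertex visited before \<open>t\<close>; a pigeonhole argument on
  a fine regular \<open>12 M\<close>-gon replaces arc length by counting.

  Suppose the cost is less than \<open>C\<close>. As long as a point is unvisited at time \<open>s\<close>, the Queen is within
  \<open>C - s\<close> of it. For two vertices at distance \<open>d\<close>, first visited at times \<open>x \<le> y\<close>, this yields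
  \<open>x + d < C\<close> if the Queen makes the first visit, \<open>2 x + d < C + y\<close> if she makes the second one, and
  \<open>2 x + d < 2 C\<close> always; moreover \<open>y - x \<ge> d\<close> if the same agent makes both visits. These linear
  constraints on the twelve visit times already have no solution. Since every agent has time only for a
  short tour of the vertices, few orders of visits are possible, and a verified search refutes them all.
\<close>

section \<open>Separated times and points of the circle\<close>

text \<open>The maximum of \<open>X\<close> on \<open>A\<close> lies at least
  \<open>\<delta>\<close> above every other value. This limits how many points a single agent can
  visit in a given time.\<close>

lemma separated_times:
  fixes X :: "'a \<Rightarrow> real"
  assumes "finite A" "A \<noteq> {}"
    and "\<And>i j. i \<in> A \<Longrightarrow> j \<in> A \<Longrightarrow> i \<noteq> j \<Longrightarrow> \<delta> \<le> \<bar>X i - X j\<bar>"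
    and "\<And>i. i \<in> A \<Longrightarrow> c \<le> X i"
  shows "\<exists>i\<in>A. c + (real (card A) - 1) * \<delta> \<le> X i"
  using assms
proof (induction "card A" arbitrary: A)
  case 0
  then show ?case by simp
next
  case (Suc n)
  obtain m where m: "m \<in> A" "\<And>i. i \<in> A \<Longrightarrow> X i \<le> X m"
    using obtains_MAX[OF Suc.prems(1,2), of X] Suc.prems(1) by (metis (no_types) Max_ge finite_imageI imageI)
  show ?case
  proof (cases "A - {m} = {}")
    case True
    then have "card A = 1"
      using m(1) by (metis Diff_eq_empty_iff empty_iff is_singletonI is_singleton_altdef subset_singletonD)
    then show ?thesis
      using m(1) Suc.prems(4) by auto
  next
    case False
    have n: "n = card (A - {m})"
      using Suc.hyps(2) m(1) Suc.prems(1) by simp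
    obtain i where i: "i \<in> A - {m}" "c + (real (card (A - {m})) - 1) * \<delta> \<le> X i"
    proof -
      have "finite (A - {m})" using Suc.prems(1) by simp
      from Suc.hyps(1)[OF n this False] Suc.prems(3,4) show ?thesis
        using that by blast
    qed
    have "\<delta> \<le> X m - X i"
      using Suc.prems(3)[of m i] m i(1) by force
    moreover have "real (card A) - 1 = real n" "real (card (A - {m})) - 1 = real n - 1"
      using n Suc.hyps(2) by simp_all
    ultimately have "c + (real (card A) - 1) * \<delta> \<le> X m"
      using i(2) by (simp only:) (simp add: algebra_simps)
    then show ?thesis
      using m(1) by blast
  qed
qed

lemma norm_diff_via:
  fixes x y z :: "'a :: real_normed_vector"
  shows "norm (x - y) \<le> norm (x - z) + norm (y - z)"
  using norm_triangle_ineq4[of "x - z" "y - z"] by simp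

lemma circle_point_eq_iff: "circle_point \<alpha> = circle_point \<beta> \<longleftrightarrow> cos \<alpha> = cos \<beta> \<and> sin \<alpha> = sin \<beta>"
  by (auto simp: circle_point_def vec_eq_iff forall_2)

lemma norm_circle_point: "norm (circle_point \<theta>) = 1"
  by (simp add: circle_point_def norm_vec_def L2_set_def sum_2)

lemma norm_circle_point_diff:
  "(norm (circle_point \<alpha> - circle_point \<beta>))\<^sup>2 = 2 - 2 * cos (\<alpha> - \<beta>)"
proof -
  have "(norm (circle_point \<alpha> - circle_point \<beta>))\<^sup>2 = (cos \<alpha> - cos \<beta>)\<^sup>2 + (sin \<alpha> - sin \<beta>)\<^sup>2"
    by (simp add: circle_point_def norm_vec_def L2_set_def sum_2)
  also have "\<dots> = ((cos \<alpha>)\<^sup>2 + (sin \<alpha>)\<^sup>2) + ((cos \<beta>)\<^sup>2 + (sin \<beta>)\<^sup>2) - 2 * (cos \<alpha> * cos \<beta> + sin \<alpha> * sin \<beta>)"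
    by (simp add: power2_eq_square algebra_simps)
  finally show ?thesis
    by (simp add: cos_diff)
qed

text \<open>Feasibility and cost speak only of angles in \<open>{0..<2 * pi}\<close>; this makes
  their consequences available for the vertices of a rotated polygon, at any angle.\<close>

lemma circle_point_reduce: "\<exists>\<theta>'\<in>{0..<2 * pi}. circle_point \<theta>' = circle_point \<theta>"
proof -
  obtain t where "0 \<le> t" "t < 2 * pi" "cos \<theta> = cos t" "sin \<theta> = sin t"
    using sincos_total_2pi[of "cos \<theta>" "sin \<theta>"] by (metis sin_cos_squared_add2)
  then show ?thesis
    by (intro bexI[of _ t]) (auto simp: circle_point_eq_iff)
qed

lemma visit_time_cong:
  "circle_point \<alpha> = circle_point \<beta> \<Longrightarrow> visit_time k \<tau> \<alpha> = visit_time k \<tau> \<beta>"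
  by (simp add: visit_time_def visited_at_def)

section \<open>Consequences of a cost below \<open>C\<close>\<close>

locale evacuation =
  fixes k :: nat and \<tau> :: "nat \<Rightarrow> real \<Rightarrow> real ^ 2" and C :: real
  assumes feas: "feasible k \<tau>" and cost: "evac_cost k \<tau> < ereal C"
begin

abbreviation T :: "real \<Rightarrow> real" where "T \<equiv> visit_time k \<tau>"

text \<open>Agents may arrive together; the constraints below hold for any choice among
  them.\<close>

definition finder :: "real \<Rightarrow> nat" where
  "finder \<theta> = (SOME i. i \<le> k \<and> \<tau> i (T \<theta>) = circle_point \<theta>)"

lemma visited_T: "visited_at k \<tau> \<theta> (T \<theta>)"
proof -
  obtain \<theta>' where t: "\<theta>' \<in> {0..<2 * pi}" "circle_point \<theta>' = circle_point \<theta>"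
    using circle_point_reduce by blast
  then show ?thesis
    using visit_time_least(1)[OF feas t(1)] visit_time_cong[OF t(2)] by (simp add: visited_at_def)
qed

lemma T_nonneg: "0 \<le> T \<theta>"
  using visited_T by (simp add: visited_at_def)

lemma finder: "finder \<theta> \<le> k" "\<tau> (finder \<theta>) (T \<theta>) = circle_point \<theta>"
proof -
  have "\<exists>i. i \<le> k \<and> \<tau> i (T \<theta>) = circle_point \<theta>"
    using visited_T by (auto simp: visited_at_def)
  from someI_ex[OF this] show "finder \<theta> \<le> k" "\<tau> (finder \<theta>) (T \<theta>) = circle_point \<theta>"
    by (auto simp: finder_def)
qed

lemma speed: "i \<le> k \<Longrightarrow> 0 \<le> s \<Longrightarrow> 0 \<le> t \<Longrightarrow> norm (\<tau> i s - \<tau> i t) \<le> \<bar>s - t\<bar>"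
  using feas by (auto simp: feasible_def evac_solution_def unit_speed_def)

lemma T_ge_1: "1 \<le> T \<theta>"
proof -
  have "\<tau> (finder \<theta>) 0 = 0"
    using feas finder(1) by (auto simp: feasible_def evac_solution_def)
  then show ?thesis
    using speed[OF finder(1), of "T \<theta>" 0 \<theta>] T_nonneg[of \<theta>] by (simp add: finder(2) norm_circle_point)
qed

lemma queen_reach: "T \<theta> + norm (circle_point \<theta> - \<tau> 0 (T \<theta>)) < C"
proof -
  obtain \<theta>' where t: "\<theta>' \<in> {0..<2 * pi}" "circle_point \<theta>' = circle_point \<theta>"
    using circle_point_reduce by blast
  have "ereal (T \<theta>' + norm (circle_point \<theta>' - \<tau> 0 (T \<theta>'))) \<le> evac_cost k \<tau>"
    unfolding evac_cost_def by (rule SUP_upper[OF t(1)])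
  then have "T \<theta>' + norm (circle_point \<theta>' - \<tau> 0 (T \<theta>')) < C"
    using cost by (metis le_less_trans less_ereal.simps(1))
  then show ?thesis
    using t(2) visit_time_cong[OF t(2)] by simp
qed

text \<open>Between \<open>s\<close> and \<open>T \<theta>\<close> the Queen moves by at most
  \<open>T \<theta> - s\<close>, so the bound at the visit time carries back to
  \<open>s\<close>.\<close>

lemma queen_reach_before:
  assumes "0 \<le> s" "s \<le> T \<theta>"
  shows "s + norm (circle_point \<theta> - \<tau> 0 s) < C"
proof -
  have "norm (circle_point \<theta> - \<tau> 0 s) \<le> norm (circle_point \<theta> - \<tau> 0 (T \<theta>)) + norm (\<tau> 0 (T \<theta>) - \<tau> 0 s)"
    using norm_triangle_ineq[of "circle_point \<theta> - \<tau> 0 (T \<theta>)" "\<tau> 0 (T \<theta>) - \<tau> 0 s"] by simp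
  then show ?thesis
    using queen_reach[of \<theta>] speed[of 0 "T \<theta>" s] assms T_nonneg[of \<theta>] by auto
qed

lemma T_less: "T \<theta> < C"
  using queen_reach[of \<theta>] norm_ge_zero[of "circle_point \<theta> - \<tau> 0 (T \<theta>)"] by linarith

lemma same_finder:
  assumes "finder \<alpha> = finder \<beta>"
  shows "norm (circle_point \<alpha> - circle_point \<beta>) \<le> \<bar>T \<alpha> - T \<beta>\<bar>"
  using speed[OF finder(1), of "T \<alpha>" "T \<beta>" \<alpha>] finder(2)[of \<alpha>] finder(2)[of \<beta>] T_nonneg assms by simp

lemma queen_then_other:
  assumes "finder \<alpha> = 0" "T \<alpha> \<le> T \<beta>"
  shows "T \<alpha> + norm (circle_point \<alpha> - circle_point \<beta>) < C"
  using queen_reach_before[OF T_nonneg assms(2)] finder(2)[of \<alpha>] assms(1) by (simp add: norm_minus_commute)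

text \<open>At time \<open>T \<alpha>\<close> the Queen is within \<open>C - T \<alpha>\<close> of
  the first point and within \<open>T \<beta> - T \<alpha>\<close> of the second, which she still
  reaches on time.\<close>

lemma other_then_queen:
  assumes "finder \<beta> = 0" "T \<alpha> \<le> T \<beta>"
  shows "2 * T \<alpha> + norm (circle_point \<alpha> - circle_point \<beta>) < C + T \<beta>"
  using queen_reach[of \<alpha>] speed[of 0 "T \<beta>" "T \<alpha>"] finder(2)[of \<beta>] assms T_nonneg
    norm_diff_via[of "circle_point \<alpha>" "circle_point \<beta>" "\<tau> 0 (T \<alpha>)"] by force

lemma two_unvisited:
  "2 * min (T \<alpha>) (T \<beta>) + norm (circle_point \<alpha> - circle_point \<beta>) < 2 * C"
proof -
  let ?s = "min (T \<alpha>) (T \<beta>)"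
  have "0 \<le> ?s" using T_nonneg by simp
  then show ?thesis
    using queen_reach_before[of ?s \<alpha>] queen_reach_before[of ?s \<beta>]
      norm_diff_via[of "circle_point \<alpha>" "circle_point \<beta>" "\<tau> 0 ?s"] by force
qed

end

section \<open>The search through visiting orders\<close>

text \<open>
  Vertices of the dodecagon are numbered \<open>0, \<dots>, 11\<close>; times and distances are integers in units of
  \<open>10\<^sup>-\<^sup>6\<close>, distances being rounded down, which keeps all constraints valid.
\<close>

definition chord :: "int \<Rightarrow> int" where
  "chord m = (if m = 1 \<or> m = 11 then 517638 else if m = 2 \<or> m = 10 then 1000000
    else if m = 3 \<or> m = 9 then 1414213 else if m = 4 \<or> m = 8 then 1732050
    else if m = 5 \<or> m = 7 then 1931851 else if m = 6 then 2000000 else 0)"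

definition gap :: "int \<Rightarrow> int \<Rightarrow> int" where
  "gap a b = chord \<bar>a - b\<bar>"

lemma gap_commute: "gap a b = gap b a"
  by (simp add: gap_def abs_minus_commute)

lemma gap_ge:
  "v \<in> {0..<12} \<Longrightarrow> w \<in> {0..<12} \<Longrightarrow> v \<noteq> w \<Longrightarrow> 517638 \<le> gap v w"
proof -
  assume "v \<in> {0..<12}" "w \<in> {0..<12}" "v \<noteq> w"
  then have "\<bar>v - w\<bar> \<in> {1, 2, 3, 4, 5, 6, 7, 8, 9, 10, 11}"
    by (simp, presburger)
  then show ?thesis
    by (auto simp: gap_def chord_def)
qed

text \<open>\<open>None\<close> stands for a Servant without a visit so far; time 0 is the moment
  before which no vertex is visited.\<close>

fun arrival :: "(int \<times> int) option \<Rightarrow> int \<Rightarrow> int" where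
  "arrival None w = 0"
| "arrival (Some (c, t)) w = t + gap c w"

text \<open>
  A triple \<open>(a, l, h)\<close> says that the Queen visits \<open>a\<close> during \<open>[l, h]\<close>. A Servant visiting \<open>w\<close> at time
  \<open>t\<close> or later forbids the Queen to be at \<open>a\<close> between the times \<open>L - gap a w\<close> and \<open>2 t + gap a w - L\<close>.
\<close>

fun delay :: "int \<Rightarrow> int \<Rightarrow> int \<Rightarrow> (int \<times> int \<times> int) list \<Rightarrow> (int \<times> int \<times> int) list" where
  "delay L w t [] = []"
| "delay L w t ((a, l, h) # Q) =
     (if l + gap a w \<le> L then (a, l, h) else (a, max l (2 * t + gap a w - L), h)) # delay L w t Q"

fun empty_window :: "(int \<times> int \<times> int) list \<Rightarrow> bool" where
  "empty_window [] = False"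
| "empty_window ((a, l, h) # Q) = (if h < l then True else empty_window Q)"

text \<open>A violation of \<open>two_unvisited\<close>, tested against the Servants' earlier visits
  \<open>S\<close> on the current branch. Lower bounds may replace the times because
  \<open>min\<close> is monotone.\<close>

fun too_far :: "int \<Rightarrow> int \<Rightarrow> int \<Rightarrow> (int \<times> int) list \<Rightarrow> bool" where
  "too_far L w t [] = False"
| "too_far L w t ((z, u) # S) = (if 2 * L < 2 * min t u + gap w z then True else too_far L w t S)"

text \<open>
  Depth-first search over the orders in which the Servants visit the vertices \<open>acc @ ws\<close>: \<open>c\<close> is the
  last visit of the current Servant, who still has to visit at least \<open>need\<close> vertices, \<open>left\<close> Servants
  come after him, and the vertices in \<open>acc\<close> have already been tried as his next one. By the pigeonhole
  principle each new Servant may be chosen to take at least an equal share of the remaining vertices.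
  The constant \<open>517638\<close> is the shortest gap.
\<close>

function refute_servants ::
  "int \<Rightarrow> (int \<times> int \<times> int) list \<Rightarrow> (int \<times> int) list \<Rightarrow> (int \<times> int) option \<Rightarrow> nat \<Rightarrow> nat \<Rightarrow>
   int list \<Rightarrow> int list \<Rightarrow> bool" where
  "refute_servants L Q S c need left acc [] =
     (if need > 0 then True else if left = 0 then False
      else refute_servants L Q S None ((length acc + left - 1) div left) (left - 1) [] acc)"
| "refute_servants L Q S c need left acc (w # ws) =
     (let t = arrival c w; Q' = delay L w t Q in
      if (if L < t + (int need - 1) * 517638 then True
          else if too_far L w t S then True
          else if empty_window Q' then True
          else refute_servants L Q' ((w, t) # S) (Some (w, t)) (need - 1) left [] (acc @ ws))
      then refute_servants L Q S c need left (w # acc) ws else False)"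
  by pat_completeness auto
termination
  by (relation "measures [\<lambda>(L, Q, S, c, need, left, acc, ws). left,
      \<lambda>(L, Q, S, c, need, left, acc, ws). length acc + length ws,
      \<lambda>(L, Q, S, c, need, left, acc, ws). length ws]") auto

text \<open>Upper bounds propagate backwards along the Queen's tour: to be at \<open>a\<close> by
  time \<open>h\<close> she must visit \<open>b\<close> by \<open>h - gap b a\<close>.\<close>

fun windows :: "int \<Rightarrow> (int \<times> int) list \<Rightarrow> (int \<times> int \<times> int) list" where
  "windows h [] = []"
| "windows h [(a, l)] = [(a, l, h)]"
| "windows h ((a, l) # (b, m) # p) = (a, l, h) # windows (h - gap b a) ((b, m) # p)"

text \<open>
  The Queen's tour is \<open>(c, t) # p\<close>, latest vertex first, with lower bounds on the visit times.
\<close>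

function refute_tours :: "int \<Rightarrow> nat \<Rightarrow> (int \<times> int) list \<Rightarrow> int \<Rightarrow> int \<Rightarrow> int list \<Rightarrow> int list \<Rightarrow> bool" where
  "refute_tours L k p c t acc [] =
     refute_servants L (windows L ((c, t) # p)) [] None ((length acc + k - 1) div k) (k - 1) [] acc"
| "refute_tours L k p c t acc (w # ws) =
     (let u = t + gap c w in
      if (if L < u then True else refute_tours L k ((c, t) # p) w u [] (acc @ ws))
      then refute_tours L k p c t (w # acc) ws else False)"
  by pat_completeness auto
termination
  by (relation "measures [\<lambda>(L, k, p, c, t, acc, ws). length acc + length ws,
      \<lambda>(L, k, p, c, t, acc, ws). length ws]") auto

section \<open>Soundness of the search\<close>

text \<open>The bound is the quotient of the cardinalities rounded up. If all classes were smaller,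
  \<open>card R\<close> would be at most \<open>card A * (?q - 1)\<close>, which is too
  small.\<close>

lemma pigeonhole_ceiling:
  assumes "finite A" "A \<noteq> {}" "finite R" "\<And>r. r \<in> R \<Longrightarrow> f r \<in> A"
  shows "\<exists>b\<in>A. (card R + card A - 1) div card A \<le> card {r \<in> R. f r = b}"
proof (rule ccontr)
  let ?q = "(card R + card A - 1) div card A"
  assume "\<not> ?thesis"
  then have less: "card {r \<in> R. f r = b} \<le> ?q - 1" "0 < ?q" if "b \<in> A" for b
    using that by force+
  have q: "0 < ?q" using less(2) assms(2) by blast
  have "card R = card (\<Union>b\<in>A. {r \<in> R. f r = b})"
    using assms(4) by (intro arg_cong[of _ _ card]) auto
  also have "\<dots> \<le> (\<Sum>b\<in>A. card {r \<in> R. f r = b})"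
    by (rule card_UN_le[OF assms(1)])
  also have "\<dots> \<le> card A * (?q - 1)"
    using sum_bounded_above[of A "\<lambda>b. card {r \<in> R. f r = b}" "?q - 1"] less(1) by simp
  finally have "card R + card A \<le> card A * (?q - 1) + card A"
    by simp
  also have "\<dots> = card A * Suc (?q - 1)"
    by simp
  also have "Suc (?q - 1) = ?q"
    using q by simp
  finally have "card R + card A \<le> card A * ?q" .
  moreover have "card A * ?q \<le> card R + card A - 1"
    by (rule times_div_less_eq_dividend)
  moreover have "0 < card A" using assms(1,2) by (simp add: card_gt_0_iff)
  ultimately show False by (meson diff_less le_trans not_less add_pos_nonneg zero_le less_one add_gr_0)
qed

text \<open>All that the search uses about visit times: \<open>X\<close> counts from the moment
  before which no vertex is visited, \<open>L\<close> bounds the time then left before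
  \<open>C\<close>, and \<open>ag\<close> gives the finder.\<close>

locale schedule =
  fixes k :: nat and X :: "int \<Rightarrow> real" and ag :: "int \<Rightarrow> nat" and L :: int
  assumes agents: "ag v \<le> k"
    and X_nonneg: "v \<in> {0..<12} \<Longrightarrow> 0 \<le> X v"
    and X_le: "v \<in> {0..<12} \<Longrightarrow> X v \<le> L"
    and same_agent: "v \<in> {0..<12} \<Longrightarrow> w \<in> {0..<12} \<Longrightarrow> ag v = ag w \<Longrightarrow> gap v w \<le> \<bar>X v - X w\<bar>"
    and queen_servant: "v \<in> {0..<12} \<Longrightarrow> w \<in> {0..<12} \<Longrightarrow> ag v = 0 \<Longrightarrow> X v \<le> X w \<Longrightarrow> X v + gap v w \<le> L"
    and servant_queen: "v \<in> {0..<12} \<Longrightarrow> w \<in> {0..<12} \<Longrightarrow> ag w = 0 \<Longrightarrow> X v \<le> X w \<Longrightarrow>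
      2 * X v + gap v w \<le> L + X w"
    and servants: "v \<in> {0..<12} \<Longrightarrow> w \<in> {0..<12} \<Longrightarrow> 2 * min (X v) (X w) + gap v w \<le> 2 * L"
begin

definition window_ok :: "int \<times> int \<times> int \<Rightarrow> bool" where
  "window_ok = (\<lambda>(a :: int, l :: int, h :: int). a \<in> {0..<12} \<and> ag a = 0 \<and> l \<le> X a \<and> X a \<le> h)"

definition visit_ok :: "int \<times> int \<Rightarrow> bool" where
  "visit_ok = (\<lambda>(z :: int, u :: int). z \<in> {0..<12} \<and> u \<le> X z)"

definition first_of :: "nat \<Rightarrow> int set \<Rightarrow> int \<Rightarrow> bool" where
  "first_of b R w \<longleftrightarrow> w \<in> R \<and> ag w = b \<and> (\<forall>r\<in>R. ag r = b \<longrightarrow> X w \<le> X r)"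

lemma ex_first_of:
  assumes "finite R" "r \<in> R" "ag r = b"
  shows "\<exists>w. first_of b R w"
proof -
  let ?B = "{r \<in> R. ag r = b}"
  have "finite ?B" "?B \<noteq> {}"
    using assms by auto
  then obtain w where w: "w \<in> ?B" "X w = Min (X ` ?B)"
    by (rule obtains_MIN[where f = X]) simp
  have "X w \<le> X r" if "r \<in> ?B" for r
    using that \<open>finite ?B\<close> w(2) by simp
  with w(1) show ?thesis
    unfolding first_of_def by blast
qed

text \<open>If \<open>l + gap a w\<close> exceeds \<open>L\<close>, then
  \<open>queen_servant\<close> forbids the Queen to reach \<open>a\<close> before \<open>w\<close>
  is visited; hence \<open>w\<close> comes first and \<open>servant_queen\<close> bounds
  \<open>X a\<close> from below.\<close>

lemma delay_ok:
  assumes "\<forall>q\<in>set Q. window_ok q" "w \<in> {0..<12}" "t \<le> X w"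
  shows "\<forall>q\<in>set (delay L w t Q). window_ok q"
  using assms(1)
proof (induction Q)
  case (Cons q Q)
  obtain a l h where q: "q = (a, l, h)" by (cases q) auto
  have a: "a \<in> {0..<12}" "ag a = 0" "l \<le> X a" "X a \<le> h"
    using Cons.prems by (auto simp: q window_ok_def)
  have "2 * t + gap a w - L \<le> X a" if "\<not> l + gap a w \<le> L"
  proof -
    have "real_of_int L < X a + gap a w"
      using that a(3) by linarith
    then have "X w \<le> X a"
      using queen_servant[OF a(1) assms(2) a(2)] by linarith
    from servant_queen[OF assms(2) a(1,2) this] assms(3) show ?thesis
      by (simp add: gap_commute)
  qed
  then have "window_ok (if l + gap a w \<le> L then (a, l, h) else (a, max l (2 * t + gap a w - L), h))"
    using a by (auto simp: window_ok_def max_def)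
  with Cons show ?case
    by (simp add: q)
qed simp

lemma not_empty_window: "\<forall>q\<in>set Q. window_ok q \<Longrightarrow> \<not> empty_window Q"
  by (induction Q rule: empty_window.induct) (auto simp: window_ok_def)

lemma not_too_far:
  assumes "\<forall>z\<in>set S. visit_ok z" "w \<in> {0..<12}" "t \<le> X w"
  shows "\<not> too_far L w t S"
  using assms(1)
proof (induction S)
  case (Cons s S)
  obtain z u where s: "s = (z, u)" by (cases s) auto
  have z: "z \<in> {0..<12}" "u \<le> X z"
    using Cons.prems by (auto simp: s visit_ok_def)
  have "2 * real_of_int (min t u) + gap w z \<le> 2 * L"
    using servants[OF assms(2) z(1)] assms(3) z(2) by (auto simp: min_def split: if_splits)
  then have "2 * min t u + gap w z \<le> 2 * L"
    by linarith
  with Cons show ?case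
    by (simp add: s)
qed simp

lemma arrival_le:
  assumes "\<And>v t. c = Some (v, t) \<Longrightarrow> v \<in> {0..<12} \<and> ag v = ag w \<and> t \<le> X v \<and> X v \<le> X w"
    and "w \<in> {0..<12}"
  shows "arrival c w \<le> X w"
proof (cases c)
  case None
  then show ?thesis using X_nonneg assms(2) by simp
next
  case (Some vt)
  then obtain v t where c: "c = Some (v, t)" by (cases vt) auto
  show ?thesis
    using assms(1)[OF c] same_agent[of v w] assms(2) c by simp
qed

text \<open>Agent \<open>b\<close> visits at least \<open>n\<close> vertices of \<open>R\<close>,
  with \<open>w\<close> the first of them, so \<open>n - 1\<close> shortest gaps fit between
  \<open>t\<close> and \<open>L\<close>.\<close>

lemma enough_time:
  fixes t :: int
  assumes "R \<subseteq> {0..<12}" "first_of b R w" "n \<le> card {r \<in> R. ag r = b}" "t \<le> X w"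
  shows "t + (int n - 1) * 517638 \<le> L"
proof -
  let ?B = "{r \<in> R. ag r = b}"
  have R: "finite R"
    using assms(1) finite_subset by blast
  have w: "w \<in> ?B" "\<And>r. r \<in> ?B \<Longrightarrow> X w \<le> X r"
    using assms(2) by (auto simp: first_of_def)
  have "\<exists>i\<in>?B. X w + (real (card ?B) - 1) * 517638 \<le> X i"
  proof (rule separated_times)
    fix i j assume "i \<in> ?B" "j \<in> ?B" "i \<noteq> j"
    then have ij: "i \<in> {0..<12}" "j \<in> {0..<12}" "ag i = ag j" "i \<noteq> j"
      using assms(1) by auto
    show "517638 \<le> \<bar>X i - X j\<bar>"
      using same_agent[OF ij(1-3)] gap_ge[OF ij(1,2,4)] by linarith
  qed (use R w in auto)
  then obtain i where i: "i \<in> ?B" "X w + (real (card ?B) - 1) * 517638 \<le> X i"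
    by blast
  have "X i \<le> L"
    using X_le i(1) assms(1) by auto
  moreover have "real n \<le> real (card ?B)"
    using assms(3) by simp
  ultimately have "t + (real n - 1) * 517638 \<le> L"
    using i(2) assms(4) by (simp add: algebra_simps)
  then have "real_of_int (t + (int n - 1) * 517638) \<le> real_of_int L"
    by simp
  then show ?thesis
    by linarith
qed

text \<open>Invariant: \<open>b\<close> is the current Servant, \<open>A\<close> holds the later
  ones, and every remaining vertex belongs to one of them. No vertex of \<open>acc\<close> is the
  next visit of \<open>b\<close>, so the true order survives in some branch.\<close>

lemma refute_servants_sound:
  assumes "refute_servants L' Q S c need left acc ws" "L' = L"
    and "set (acc @ ws) \<subseteq> {0..<12}" "distinct (acc @ ws)"
    and "\<forall>q\<in>set Q. window_ok q" "\<forall>s\<in>set S. visit_ok s"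
    and "finite A" "card A = left" "b \<notin> A" "\<forall>r\<in>set (acc @ ws). ag r \<in> insert b A"
    and "\<And>v t r. c = Some (v, t) \<Longrightarrow> r \<in> set (acc @ ws) \<Longrightarrow> ag r = b \<Longrightarrow>
      v \<in> {0..<12} \<and> ag v = b \<and> t \<le> X v \<and> X v \<le> X r"
    and "need \<le> card {r \<in> set (acc @ ws). ag r = b}"
    and "\<forall>r\<in>set acc. \<not> first_of b (set (acc @ ws)) r"
  shows False
  using assms
proof (induction L' Q S c need left acc ws arbitrary: A b rule: refute_servants.induct)
  case (1 L' Q S c need left acc)
  note prems = "1.prems"
  \<comment> \<open>With all candidates ruled out as the next visit, \<open>b\<close> has no
    vertices left, and the search must turn to another Servant.\<close>
  have none: "ag r \<noteq> b" if r: "r \<in> set acc" for r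
  proof
    assume "ag r = b"
    then obtain w where "first_of b (set acc) w"
      using ex_first_of[of "set acc" r b] r by auto
    then show False
      using prems(13) by (auto simp: first_of_def)
  qed
  then have "{r \<in> set (acc @ []). ag r = b} = {}"
    by auto
  then have "need = 0"
    using prems(12) by (simp only: card.empty)
  with prems(1) have left: "left \<noteq> 0"
    and next_servant: "refute_servants L' Q S None ((length acc + left - 1) div left) (left - 1) [] acc"
    by (auto split: if_splits)
  have A: "A \<noteq> {}" "\<And>r. r \<in> set acc \<Longrightarrow> ag r \<in> A"
    using prems(8,10) none left by auto
  have "card (set acc) = length acc"
    using prems(4) distinct_card by simp
  then obtain b' where b': "b' \<in> A" "(length acc + left - 1) div left \<le> card {r \<in> set acc. ag r = b'}"
    using pigeonhole_ceiling[OF prems(7) A(1), of "set acc" ag] A(2) prems(8) by auto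
  show ?case
    by (rule "1.IH"[of "A - {b'}" b'])
      (use prems(2-8) A b' left next_servant \<open>need = 0\<close> in auto)
next
  case (2 L' Q S c need left acc w ws)
  note prems = "2.prems"
  let ?t = "arrival c w"
  let ?R = "set (acc @ w # ws)"
  have tail: "refute_servants L' Q S c need left (w # acc) ws"
    and head: "L < ?t + (int need - 1) * 517638 \<or> too_far L w ?t S \<or> empty_window (delay L w ?t Q) \<or>
      refute_servants L (delay L w ?t Q) ((w, ?t) # S) (Some (w, ?t)) (need - 1) left [] (acc @ ws)"
    using prems(1,2) by (auto simp: Let_def split: if_splits)
  have w: "w \<in> {0..<12}"
    using prems(3) by simp
  show ?case
  proof (cases "first_of b ?R w")
    case True
    have t: "?t \<le> X w"
      using prems(11) True w by (intro arrival_le) (auto simp: first_of_def)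
    have Q: "\<forall>q\<in>set (delay L w ?t Q). window_ok q"
      by (rule delay_ok[OF prems(5) w t])
    have ok: "\<not> L < ?t + (int need - 1) * 517638" "\<not> too_far L w ?t S" "\<not> empty_window (delay L w ?t Q)"
      using enough_time[OF prems(3) True prems(12) t] not_too_far[OF prems(6) w t] not_empty_window[OF Q]
      by auto
    \<comment> \<open>Exactly one vertex of \<open>b\<close> is used up, matching the decrease of
      \<open>need\<close>.\<close>
    have "{r \<in> set ([] @ acc @ ws). ag r = b} = {r \<in> ?R. ag r = b} - {w}"
      using prems(4) by auto
    moreover have "w \<in> {r \<in> ?R. ag r = b}"
      using True by (simp add: first_of_def)
    ultimately have card: "need - 1 \<le> card {r \<in> set ([] @ acc @ ws). ag r = b}"
      using prems(12) by (simp del: set_append)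
    show ?thesis
      by (rule "2.IH"(1)[OF refl refl, of A b])
        (use ok head prems(2-10) Q t w card True in \<open>auto simp: visit_ok_def first_of_def\<close>)
  next
    case False
    show ?thesis
      by (rule "2.IH"(2)[OF refl refl, of A b])
        (use tail head prems False in auto)
  qed
qed

lemma windows_ok:
  assumes "\<forall>(a :: int, l :: int)\<in>set p. a \<in> {0..<12} \<and> ag a = 0 \<and> l \<le> X a"
    and "successively (\<lambda>(a :: int, l :: int) (b :: int, m :: int). X b + gap b a \<le> X a) p"
    and "p \<noteq> [] \<Longrightarrow> X (fst (hd p)) \<le> h"
  shows "\<forall>q\<in>set (windows h p). window_ok q"
  using assms by (induction h p rule: windows.induct) (auto simp: window_ok_def)

text \<open>The same scheme with agent 0 as the current one. Once her tour has ended, all remaining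
  vertices belong to Servants, one of whom takes at least an equal share.\<close>

lemma refute_tours_sound:
  assumes "refute_tours L' k' p c t acc ws" "L' = L" "k' = k" "0 < k"
    and "set (acc @ ws) \<subseteq> {0..<12}" "distinct (acc @ ws)"
    and "\<forall>(a :: int, l :: int)\<in>set ((c, t) # p). a \<in> {0..<12} \<and> ag a = 0 \<and> l \<le> X a"
    and "successively (\<lambda>(a :: int, l :: int) (b :: int, m :: int). X b + gap b a \<le> X a) ((c, t) # p)"
    and "\<forall>r\<in>set (acc @ ws). ag r = 0 \<longrightarrow> X c \<le> X r"
    and "\<forall>r\<in>set acc. \<not> first_of 0 (set (acc @ ws)) r"
  shows False
  using assms
proof (induction L' k' p c t acc ws rule: refute_tours.induct)
  case (1 L' k' p c t acc)
  note prems = "1.prems"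
  have none: "ag r \<noteq> 0" if r: "r \<in> set acc" for r
  proof
    assume "ag r = 0"
    then obtain w where "first_of 0 (set acc) w"
      using ex_first_of[of "set acc" r 0] r by auto
    then show False
      using prems(10) by (auto simp: first_of_def)
  qed
  have "c \<in> {0..<12}"
    using prems(7) by simp
  then have Q: "\<forall>q\<in>set (windows L ((c, t) # p)). window_ok q"
    using X_le by (intro windows_ok[OF prems(7,8)]) simp
  have servants: "\<And>r. r \<in> set acc \<Longrightarrow> ag r \<in> {1..k}"
    using none agents by (simp add: Suc_leI)
  have "card (set acc) = length acc"
    using prems(6) distinct_card by simp
  then obtain b where b: "b \<in> {1..k}" "(length acc + k - 1) div k \<le> card {r \<in> set acc. ag r = b}"
    using pigeonhole_ceiling[of "{1..k}" "set acc" ag] servants prems(4) by auto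
  have "refute_servants L (windows L ((c, t) # p)) [] None ((length acc + k - 1) div k) (k - 1) [] acc"
    using prems(1-3) by simp
  then show ?case
    by (rule refute_servants_sound[of _ _ _ _ _ _ _ _ "{1..k} - {b}" b])
      (use prems(4-6) Q b servants in auto)
next
  case (2 L' k' p c t acc w ws)
  note prems = "2.prems"
  let ?u = "t + gap c w"
  let ?R = "set (acc @ w # ws)"
  have tail: "refute_tours L' k' p c t (w # acc) ws"
    and head: "L' < ?u \<or> refute_tours L' k' ((c, t) # p) w ?u [] (acc @ ws)"
    using prems(1) by (auto simp: Let_def split: if_splits)
  have w: "w \<in> {0..<12}"
    using prems(5) by simp
  have c: "c \<in> {0..<12}" "ag c = 0" "t \<le> X c"
    using prems(7) by auto
  show ?case
  proof (cases "first_of 0 ?R w")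
    case True
    then have "ag w = 0" "X c \<le> X w" "\<forall>r\<in>?R. ag r = 0 \<longrightarrow> X w \<le> X r"
      using prems(9) by (auto simp: first_of_def)
    moreover from this have step: "X c + gap c w \<le> X w"
      using same_agent[OF c(1) w] c(2) by simp
    moreover have "\<not> L' < ?u"
      using step c(3) X_le[OF w] prems(2) by linarith
    ultimately show ?thesis
      by (intro "2.IH"(1)[OF refl]) (use head c w prems(2-8) in auto)
  next
    case False
    show ?thesis
      by (rule "2.IH"(2)[OF refl]) (use tail head prems False in auto)
  qed
qed

lemma unsatisfiable:
  assumes "0 < k"
    and "refute_tours L k [] 0 0 [] [1, 2, 3, 4, 5, 6, 7, 8, 9, 10, 11]"
    and "ag 0 = 0" "\<And>v. v \<in> {0..<12} \<Longrightarrow> ag v = 0 \<Longrightarrow> X 0 \<le> X v"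
  shows False
  by (rule refute_tours_sound[OF assms(2) refl refl assms(1)]) (use assms(3,4) X_nonneg in auto)

lemma unsatisfiable_without_queen:
  assumes "0 < k"
    and "refute_servants L [] [] None ((12 + k - 1) div k) (k - 1) [] [0, 1, 2, 3, 4, 5, 6, 7, 8, 9, 10, 11]"
    and "\<And>v. v \<in> {0..<12} \<Longrightarrow> ag v \<noteq> 0"
  shows False
proof -
  let ?R = "[0, 1, 2, 3, 4, 5, 6, 7, 8, 9, 10, 11 :: int]"
  have servants: "\<And>r. r \<in> set ?R \<Longrightarrow> ag r \<in> {1..k}"
    using assms(3) agents by (auto simp: Suc_le_eq)
  have "card (set ?R) = 12" by simp
  then obtain b where b: "b \<in> {1..k}" "(12 + k - 1) div k \<le> card {r \<in> set ?R. ag r = b}"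
    using pigeonhole_ceiling[of "{1..k}" "set ?R" ag] servants assms(1)
    by (metis (no_types, lifting) List.finite_set atLeastAtMost_iff card_atLeastAtMost diff_Suc_1 empty_iff finite_atLeastAtMost le_refl Suc_leI One_nat_def)
  show False
    by (rule refute_servants_sound[OF assms(2) refl, of "{1..k} - {b}" b])
      (use b servants in auto)
qed

end

section \<open>Distances in the dodecagon\<close>

lemma chord_le:
  fixes m :: int and r :: real
  assumes "m \<in> {0..<12}" "0 \<le> r" "r\<^sup>2 = 2 - 2 * cos (real_of_int m * pi / 6)"
  shows "chord m \<le> 1000000 * r"
proof -
  \<comment> \<open>This symmetry reduces \<open>m > 6\<close> to \<open>m < 6\<close>.\<close>
  have refl: "cos (real_of_int m * pi / 6) = cos (real_of_int (12 - m) * pi / 6)"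
    using cos_periodic[of "- (real_of_int m * pi / 6)"] by (simp add: field_simps)
  \<comment> \<open>The upper bound serves \<open>m = 1\<close>, where \<open>0.517638\<close>
    squared is just below \<open>2 - 1.7320509\<close>; the lower one serves
    \<open>m = 5\<close>.\<close>
  have sqrt3: "sqrt 3 \<le> 1.7320509" "1.73205 \<le> sqrt 3"
    by (rule real_le_lsqrt, simp_all add: power2_eq_square del: divide_le_eq_numeral1 le_divide_eq_numeral1)
      (rule real_le_rsqrt, simp add: power2_eq_square)
  have vals: "cos (pi / 6) = sqrt 3 / 2" "cos (2 * pi / 6) = 1 / 2" "cos (3 * pi / 6) = 0"
    "cos (4 * pi / 6) = - 1 / 2" "cos (5 * pi / 6) = - sqrt 3 / 2" "cos (6 * pi / 6) = - 1"
    using cos_30 cos_60 cos_pi_minus[of "pi / 3"] cos_pi_minus[of "pi / 6"]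
    by (simp_all add: field_simps)
  have sq: "(chord m / 1000000)\<^sup>2 \<le> r\<^sup>2"
  proof -
    have "m \<in> {0, 1, 2, 3, 4, 5, 6, 7, 8, 9, 10, 11}"
      using assms(1) by (simp, presburger)
    then show ?thesis
      using sqrt3 vals refl unfolding assms(3)
      by (elim insertE emptyE) (simp_all add: chord_def power2_eq_square)
  qed
  have "chord m / 1000000 \<le> r"
    using sq assms(2) by (rule power2_le_imp_le)
  then show ?thesis by simp
qed

lemma gap_le_dist:
  assumes "v \<in> {0..<12}" "w \<in> {0..<12}"
  shows "gap v w \<le> 1000000 * norm (circle_point (\<phi> + real_of_int v * pi / 6) - circle_point (\<phi> + real_of_int w * pi / 6))"
  unfolding gap_def
proof (rule chord_le)
  let ?r = "norm (circle_point (\<phi> + real_of_int v * pi / 6) - circle_point (\<phi> + real_of_int w * pi / 6))"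
  have "?r\<^sup>2 = 2 - 2 * cos (real_of_int (v - w) * pi / 6)"
    unfolding norm_circle_point_diff by (simp add: algebra_simps diff_divide_distrib)
  also have "cos (real_of_int (v - w) * pi / 6) = cos (real_of_int \<bar>v - w\<bar> * pi / 6)"
    using cos_abs_real[of "real_of_int (v - w) * pi / 6"] by (simp add: abs_mult)
  finally show "?r\<^sup>2 = 2 - 2 * cos (real_of_int \<bar>v - w\<bar> * pi / 6)" .
qed (use assms in auto)

lemma cos_le_cos_near:
  assumes "0 \<le> \<delta>" "\<delta> \<le> \<bar>x\<bar>" "\<bar>x\<bar> \<le> 2 * pi - \<delta>"
  shows "cos x \<le> cos \<delta>"
proof (cases "\<bar>x\<bar> \<le> pi")
  case True
  then have "cos \<bar>x\<bar> \<le> cos \<delta>"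
    using assms by (intro cos_monotone_0_pi_le) auto
  then show ?thesis by simp
next
  case False
  then have "cos (2 * pi - \<bar>x\<bar>) \<le> cos \<delta>"
    using assms by (intro cos_monotone_0_pi_le) auto
  then show ?thesis by simp
qed

section \<open>An unvisited dodecagon and its schedule\<close>

context evacuation
begin

lemma T_periodic: "T (\<theta> + 2 * pi * of_int n) = T \<theta>"
  by (rule visit_time_cong) (simp add: circle_point_eq_iff sin_add cos_add)

lemma ex_unvisited_dodecagon:
  assumes "1 \<le> t" "(real k + 1) * (t - 1) < pi / 6"
  shows "\<exists>\<phi>. \<forall>i :: int. t \<le> T (\<phi> + of_int i * pi / 6)"
proof -
  \<comment> \<open>The side of the regular \<open>12 M\<close>-gon. As \<open>M\<close> grows,
    \<open>M * \<delta> M\<close> tends to \<open>pi / 6\<close>, and the extra side counted for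
    each agent vanishes.\<close>
  define \<delta> where "\<delta> M = 2 * sin (pi / (12 * real M))" for M :: nat
  have "((\<lambda>M. real M * \<delta> M - (real k + 1) * (\<delta> M + (t - 1))) \<longlongrightarrow> pi / 6 - (real k + 1) * (0 + (t - 1))) sequentially"
    unfolding \<delta>_def by (intro tendsto_intros; real_asymp)
  then have "\<forall>\<^sub>F M in sequentially. 0 < real M * \<delta> M - (real k + 1) * (\<delta> M + (t - 1))"
    by (rule order_tendstoD(1)) (use assms(2) in simp)
  then have "\<forall>\<^sub>F M in sequentially. 0 < M \<and> 0 < real M * \<delta> M - (real k + 1) * (\<delta> M + (t - 1))"
    using eventually_gt_at_top[of "0 :: nat"] by eventually_elim simp
  then obtain M where M: "0 < M" "(real k + 1) * (\<delta> M + (t - 1)) < real M * \<delta> M"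
    by (auto simp: eventually_sequentially)
  have \<delta>: "0 < \<delta> M"
    unfolding \<delta>_def using M(1) by (intro mult_pos_pos sin_gt_zero) (auto simp: field_simps)
  define ang where "ang m = real m * (pi / (6 * real M))" for m
  have sep: "\<delta> M \<le> norm (circle_point (ang m) - circle_point (ang n))"
    if "m < 12 * M" "n < 12 * M" "m \<noteq> n" for m n
  proof -
    have "\<bar>real m - real n\<bar> \<ge> 1" "\<bar>real m - real n\<bar> \<le> 12 * real M - 1"
      using that by linarith+
    moreover have "\<bar>ang m - ang n\<bar> = \<bar>real m - real n\<bar> * (pi / (6 * real M))"
      unfolding ang_def left_diff_distrib[symmetric] abs_mult by simp
    moreover have "(12 * real M - 1) * (pi / (6 * real M)) = 2 * pi - pi / (6 * real M)"
      using M(1) by (simp add: field_simps)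
    ultimately have "cos (ang m - ang n) \<le> cos (pi / (6 * real M))"
      by (intro cos_le_cos_near) (metis divide_nonneg_nonneg mult_right_mono mult_1 pi_ge_zero of_nat_0_le_iff mult_nonneg_nonneg zero_le_numeral)+
    moreover have "cos (pi / (6 * real M)) = 1 - 2 * (sin (pi / (12 * real M)))\<^sup>2"
      using cos_double_sin[of "pi / (12 * real M)"] by (simp add: field_simps)
    ultimately have "(\<delta> M)\<^sup>2 \<le> (norm (circle_point (ang m) - circle_point (ang n)))\<^sup>2"
      unfolding norm_circle_point_diff by (simp add: \<delta>_def power_mult_distrib)
    then show ?thesis
      by (rule power2_le_imp_le) simp
  qed
  let ?B = "\<lambda>a. {m. m < 12 * M \<and> T (ang m) < t \<and> finder (ang m) = a}"
  \<comment> \<open>An agent reaches its first vertex no earlier than time 1 and then needs at least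
    \<open>\<delta> M\<close> per further vertex.\<close>
  have few: "real (card (?B a)) * \<delta> M \<le> \<delta> M + (t - 1)" for a
  proof (cases "?B a = {}")
    case True
    then show ?thesis
      using \<delta> assms(1) by (simp only: card.empty)
  next
    case False
    have "\<exists>m\<in>?B a. 1 + (real (card (?B a)) - 1) * \<delta> M \<le> T (ang m)"
    proof (rule separated_times[OF _ False])
      fix m n assume mn: "m \<in> ?B a" "n \<in> ?B a" "m \<noteq> n"
      then show "\<delta> M \<le> \<bar>T (ang m) - T (ang n)\<bar>"
        using sep[of m n] same_finder[of "ang m" "ang n"] by force
    qed (auto intro: T_ge_1)
    then show ?thesis
      by (force simp: algebra_simps)
  qed
  let ?A = "{m. m < 12 * M \<and> T (ang m) < t}"
  have "?A = (\<Union>a\<le>k. ?B a)"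
    using finder(1) by auto
  then have "real (card ?A) \<le> real (\<Sum>a\<le>k. card (?B a))"
    using card_UN_le[of "{..k}" ?B] by (simp del: of_nat_sum)
  then have "real (card ?A) * \<delta> M \<le> (\<Sum>a\<le>k. real (card (?B a)) * \<delta> M)"
    using \<delta> by (simp flip: sum_distrib_right)
  also have "\<dots> \<le> (\<Sum>a\<le>k. \<delta> M + (t - 1))"
    by (intro sum_mono few)
  also have "\<dots> < real M * \<delta> M"
    using M(2) by (simp add: algebra_simps)
  finally have "card ?A < M"
    using \<delta> by simp
  \<comment> \<open>Each residue class modulo \<open>M\<close> forms a dodecagon; fewer than
    \<open>M\<close> visited vertices leave some class untouched.\<close>
  then have "card ((\<lambda>m. m mod M) ` ?A) < card {..<M}"
    using card_image_le[of ?A "\<lambda>m. m mod M"] by simp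
  then have "\<not> {..<M} \<subseteq> (\<lambda>m. m mod M) ` ?A"
    using card_mono[of "(\<lambda>m. m mod M) ` ?A" "{..<M}"] by auto
  then obtain j where j: "j < M" "j \<notin> (\<lambda>m. m mod M) ` ?A"
    by auto
  have "t \<le> T (ang j + of_int i * pi / 6)" for i :: int
  proof -
    define n where "n = nat (i mod 12)"
    have n: "n < 12" "int n = i mod 12"
      by (auto simp: n_def)
    have "n * M \<le> 11 * M"
      using n(1) by simp
    then have less: "j + n * M < 12 * M"
      using j(1) by linarith
    have "j + n * M \<notin> ?A"
    proof
      assume "j + n * M \<in> ?A"
      then have "(j + n * M) mod M \<in> (\<lambda>m. m mod M) ` ?A"
        by (rule imageI)
      then show False
        using j by simp
    qed
    then have "t \<le> T (ang (j + n * M))"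
      using less by simp
    moreover have "ang j + of_int i * pi / 6 = ang (j + n * M) + 2 * pi * of_int (i div 12)"
    proof -
      have "of_int i = real n + 12 * of_int (i div 12)"
        using n(2) by (metis (no_types) mod_mult_div_eq of_int_add of_int_mult of_int_numeral of_int_of_nat_eq)
      then show ?thesis
        using M(1) by (simp add: ang_def field_simps)
    qed
    ultimately show ?thesis
      by (simp add: T_periodic)
  qed
  then show ?thesis by blast
qed

lemma finder_cong: "circle_point \<alpha> = circle_point \<beta> \<Longrightarrow> finder \<alpha> = finder \<beta>"
  using visit_time_cong[of \<alpha> \<beta> k \<tau>] by (simp add: finder_def)

text \<open>Each constraint is an inequality of \<open>evacuation\<close>, shifted by
  \<open>t\<close> and scaled; \<open>gap\<close> underestimates the scaled distance and
  \<open>L\<close> overestimates \<open>C - t\<close>.\<close>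

lemma schedule_dodecagon:
  assumes "\<And>i :: int. t \<le> T (\<phi> + of_int i * pi / 6)" "1000000 * (C - t) \<le> real_of_int L"
  shows "schedule k (\<lambda>i. 1000000 * (T (\<phi> + of_int i * pi / 6) - t)) (\<lambda>i. finder (\<phi> + of_int i * pi / 6)) L"
proof -
  define ang where "ang i = \<phi> + of_int i * pi / 6" for i :: int
  have L: "1000000 * C \<le> L + 1000000 * t"
    using assms(2) by (simp add: algebra_simps)
  have gap: "gap v w \<le> 1000000 * norm (circle_point (ang v) - circle_point (ang w))"
    if "v \<in> {0..<12}" "w \<in> {0..<12}" for v w
    unfolding ang_def using gap_le_dist[OF that] .
  have "schedule k (\<lambda>i. 1000000 * (T (ang i) - t)) (\<lambda>i. finder (ang i)) L"
  proof
    fix v w :: int assume v: "v \<in> {0..<12}" and w: "w \<in> {0..<12}"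
    note gap = gap[OF v w]
    show "0 \<le> 1000000 * (T (ang v) - t)"
      using assms(1) by (simp add: ang_def)
    show "1000000 * (T (ang v) - t) \<le> L"
      using T_less[of "ang v"] L by (simp add: right_diff_distrib)
    show "gap v w \<le> \<bar>1000000 * (T (ang v) - t) - 1000000 * (T (ang w) - t)\<bar>"
      if "finder (ang v) = finder (ang w)"
      using same_finder[OF that] gap unfolding right_diff_distrib[symmetric] abs_mult by simp
    show "1000000 * (T (ang v) - t) + gap v w \<le> L"
      if "finder (ang v) = 0" "1000000 * (T (ang v) - t) \<le> 1000000 * (T (ang w) - t)"
      using queen_then_other[of "ang v" "ang w"] that gap L by simp
    show "2 * (1000000 * (T (ang v) - t)) + gap v w \<le> L + 1000000 * (T (ang w) - t)"
      if "finder (ang w) = 0" "1000000 * (T (ang v) - t) \<le> 1000000 * (T (ang w) - t)"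
      using other_then_queen[of "ang w" "ang v"] that gap L by simp
    show "2 * min (1000000 * (T (ang v) - t)) (1000000 * (T (ang w) - t)) + gap v w \<le> 2 * L"
      using two_unvisited[of "ang v" "ang w"] gap L by (simp add: min_def right_diff_distrib split: if_splits)
  qed (rule finder(1))
  then show ?thesis
    by (simp add: ang_def)
qed

lemma refuted:
  assumes "0 < k" "1 \<le> t" "(real k + 1) * (t - 1) < pi / 6" "1000000 * (C - t) \<le> real_of_int L"
    and queen: "refute_tours L k [] 0 0 [] [1, 2, 3, 4, 5, 6, 7, 8, 9, 10, 11]"
    and no_queen: "refute_servants L [] [] None ((12 + k - 1) div k) (k - 1) [] [0, 1, 2, 3, 4, 5, 6, 7, 8, 9, 10, 11]"
  shows False
proof -
  obtain \<phi> where \<phi>: "\<And>i :: int. t \<le> T (\<phi> + of_int i * pi / 6)"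
    using ex_unvisited_dodecagon[OF assms(2,3)] by blast
  define ang where "ang i = \<phi> + of_int i * pi / 6" for i :: int
  let ?V = "{v \<in> {0..<12}. finder (ang v) = 0}"
  show False
  proof (cases "?V = {}")
    case True
    interpret schedule k "\<lambda>i. 1000000 * (T (\<phi> + of_int i * pi / 6) - t)" "\<lambda>i. finder (\<phi> + of_int i * pi / 6)" L
      by (rule schedule_dodecagon[OF \<phi> assms(4)])
    show False
      by (rule unsatisfiable_without_queen[OF assms(1) no_queen]) (use True in \<open>auto simp: ang_def\<close>)
  next
    case False
    have "finite ?V"
      by (rule finite_subset[of _ "{0..<12}"]) auto
    \<comment> \<open>Renumbering from \<open>i0\<close> makes the Queen's earliest vertex number 0,
      as \<open>unsatisfiable\<close> requires.\<close>
    then obtain i0 where i0: "i0 \<in> ?V" "T (ang i0) = Min ((\<lambda>v. T (ang v)) ` ?V)"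
      using False by (rule obtains_MIN[where f = "\<lambda>v. T (ang v)"]) simp
    have first: "T (ang i0) \<le> T (ang v)" if "finder (ang v) = 0" for v
    proof -
      \<comment> \<open>Indices counted from \<open>i0\<close> can exceed 11; reduction modulo 12
        changes the angle by full turns only.\<close>
      have "ang v = ang (v mod 12) + 2 * pi * of_int (v div 12)"
      proof -
        have "real_of_int v = of_int (v mod 12) + 12 * of_int (v div 12)"
          by (metis mod_mult_div_eq of_int_add of_int_mult of_int_numeral)
        then show ?thesis
          by (simp add: ang_def field_simps)
      qed
      then have eq: "circle_point (ang v) = circle_point (ang (v mod 12))"
        by (simp add: circle_point_eq_iff sin_add cos_add)
      then have "v mod 12 \<in> ?V"
        using that finder_cong[OF eq] by simp
      then have "T (ang i0) \<le> T (ang (v mod 12))"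
        using i0(2) \<open>finite ?V\<close> by simp
      then show ?thesis
        using visit_time_cong[OF eq] by simp
    qed
    have ang_add: "ang i0 + of_int i * pi / 6 = ang (i0 + i)" for i
      by (simp add: ang_def algebra_simps add_divide_distrib)
    have "t \<le> T (ang i0 + of_int i * pi / 6)" for i
      unfolding ang_add by (simp only: ang_def \<phi>)
    then interpret schedule k "\<lambda>i. 1000000 * (T (ang i0 + of_int i * pi / 6) - t)"
        "\<lambda>i. finder (ang i0 + of_int i * pi / 6)" L
      using assms(4) by (rule schedule_dodecagon)
    show False
      by (rule unsatisfiable[OF assms(1) queen]) (use i0(1) first in \<open>simp_all add: ang_add\<close>)
  qed
qed

end

section \<open>Evaluation for one and two Servants\<close>

text \<open>
  The time available after the start \<open>t\<close> is \<open>C - t\<close>, in units of \<open>10\<^sup>-\<^sup>6\<close>: here \<open>t = 1.261799\<close> is just below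
  \<open>1 + \<pi>/12\<close>, and \<open>t = 1.17452\<close> just below \<open>1 + \<pi>/18\<close>.
\<close>

lemma refuted_one_servant:
  "refute_tours 3384861 1 [] 0 0 [] [1, 2, 3, 4, 5, 6, 7, 8, 9, 10, 11]"
  by code_simp

lemma refuted_two_servants:
  "refute_tours 2478800 2 [] 0 0 [] [1, 2, 3, 4, 5, 6, 7, 8, 9, 10, 11]"
  by code_simp

text \<open>Some Servant visits at least 12 or 6 vertices, respectively, but already 11 or 5
  shortest gaps exceed the time available. The quotients stay unevaluated to match
  \<open>no_queen\<close> in \<open>refuted\<close>.\<close>

lemma refuted_without_queen:
  "refute_servants 3384861 [] [] None ((12 + 1 - 1) div 1) (1 - 1) [] [0, 1, 2, 3, 4, 5, 6, 7, 8, 9, 10, 11]"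
  "refute_servants 2478800 [] [] None ((12 + 2 - 1) div 2) (2 - 1) [] [0, 1, 2, 3, 4, 5, 6, 7, 8, 9, 10, 11]"
  by code_simp+

theorem theorem2:
  shows "(\<forall>\<tau>. feasible 1 \<tau> \<longrightarrow> evac_cost 1 \<tau> \<ge> ereal 4.64666) \<and>
         (\<forall>\<tau>. feasible 2 \<tau> \<longrightarrow> evac_cost 2 \<tau> \<ge> ereal 3.65332)"
proof (intro conjI allI impI; rule ccontr)
  fix \<tau> assume "feasible 1 \<tau>" "\<not> evac_cost 1 \<tau> \<ge> ereal 4.64666"
  then interpret evacuation 1 \<tau> "4.64666"
    by unfold_locales auto
  show False
    by (rule refuted[OF _ _ _ _ refuted_one_servant refuted_without_queen(1), of "1.261799"])
      (use pi_approx(1) in auto)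
next
  fix \<tau> assume "feasible 2 \<tau>" "\<not> evac_cost 2 \<tau> \<ge> ereal 3.65332"
  then interpret evacuation 2 \<tau> "3.65332"
    by unfold_locales auto
  show False
    by (rule refuted[OF _ _ _ _ refuted_two_servants refuted_without_queen(2), of "1.17452"])
      (use pi_approx(1) in auto)
qed

end
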